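(* Let $p_0,p_1$ be two distinct probability densities on $\mathbb{R}^d$ with identical support, with corresponding probability measures $P_0,P_1$, let $\pi_0,\pi_1$ be the prior probabilities of the two hypotheses, and let the error requirements $\mathrm{P}_\mathrm{F},\mathrm{P}_\mathrm{M}$ be fixed. Let $\mathcal{R}$ be a class of positive measurable functions on the sample space. Then the average stopping time of the SPRT, $$\mathrm{C}=\frac{\pi_0\omega_0}{\mathrm{D}_{01}}+\frac{\pi_1\omega_1}{\mathrm{D}_{10}},$$ is bounded above by the optimal value of the problem $$\min_{\hat r\in\mathcal{R},\ \hat r\not\equiv 1}\ -\frac{\pi_0\omega_0}{\int\log(\hat r)\,\mathrm{d}P_0}+\frac{\pi_1\omega_1}{\int\log(\hat r)\,\mathrm{d}P_1}\quad\text{subject to}\quad \int\hat r\,\mathrm{d}P_0=1,\quad \int\hat r^{-1}\,\mathrm{d}P_1=1.$$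
   Context: The SPRT (sequential probability ratio test) for $\mathrm{H}_0:\mathbf{x}_i\sim p_0$ i.i.d. versus $\mathrm{H}_1:\mathbf{x}_i\sim p_1$ i.i.d. accumulates $\sum_{i\le T}\log r(\mathbf{x}_i)$ with $r=p_1/p_0$, and stops when this sum first leaves an interval $(a,b)$, $a<0<b$, declaring $\mathrm{H}_1$ at the upper boundary and $\mathrm{H}_0$ at the lower one. $\mathrm{P}_\mathrm{F}\in(0,1)$ and $\mathrm{P}_\mathrm{M}\in(0,1)$ are the required false alarm and miss detection probabilities. $\mathrm{D}_{01}=-\int\log r\,\mathrm{d}P_0$ and $\mathrm{D}_{10}=\int\log r\,\mathrm{d}P_1$ are the two Kullback-Leibler divergences. The weights are $$\omega_0=\mathrm{P}_\mathrm{F}\log\frac{\mathrm{P}_\mathrm{F}}{1-\mathrm{P}_\mathrm{M}}+(1-\mathrm{P}_\mathrm{F})\log\frac{1-\mathrm{P}_\mathrm{F}}{\mathrm{P}_\mathrm{M}},\qquad \omega_1=\mathrm{P}_\mathrm{M}\log\frac{\mathrm{P}_\mathrm{M}}{1-\mathrm{P}_\mathrm{F}}+(1-\mathrm{P}_\mathrm{M})\log\frac{1-\mathrm{P}_\mathrm{M}}{\mathrm{P}_\mathrm{F}}.$$ The average stopping time of the SPRT is evaluated by Wald's zero-overshoot formulas: the expected number of samples under $\mathrm{H}_0$ is $\omega_0/\mathrm{D}_{01}$ and under $\mathrm{H}_1$ is $\omega_1/\mathrm{D}_{10}$, giving the prior-weighted average $\mathrm{C}$. Conventions: $c/\infty=0$;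 $\hat r\not\equiv1$ means that $\hat r$ is not almost everywhere equal to $1$ (with respect to $P_0$, equivalently $P_1$); the optimal value of an infeasible problem is $+\infty$, and "min" is read as infimum if it is not attained. *)

theory Defs
  imports "HOL-Probability.Probability"
begin

(* Lebesgue integral with values in [-oo, oo] (the Bochner integral would return 0 for a
   non-integrable f). Since ennreal truncates negative reals to 0, the two summands are the
   integrals of the positive and of the negative part. It is the usual integral whenever one of
   these is finite. In the uses below one always is: ln t <= t - 1, while the integrals of
   p1/p0 and rh w.r.t. P0, and of p0/p1 and 1/rh w.r.t. P1, are at most 1. *)
definition ereal_integral :: "'a measure \<Rightarrow> ('a \<Rightarrow> real) \<Rightarrow> ereal" where
  "ereal_integral M f =
     enn2ereal (\<integral>\<^sup>+x. ennreal (f x) \<partial>M) - enn2ereal (\<integral>\<^sup>+x. ennreal (- f x) \<partial>M)"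

definition prob_of :: "(real ^ 'd \<Rightarrow> real) \<Rightarrow> (real ^ 'd) measure" where
  "prob_of p = density lborel (\<lambda>x. ennreal (p x))"

definition is_prob_density :: "(real ^ 'd \<Rightarrow> real) \<Rightarrow> bool" where
  "is_prob_density p \<longleftrightarrow>
     p \<in> borel_measurable borel \<and> (\<forall>x. 0 \<le> p x) \<and> prob_space (prob_of p)"

(* Outside the common support the quotient is 0/0 = 0; that set is null for P0 and P1. *)
definition lik_ratio :: "(real ^ 'd \<Rightarrow> real) \<Rightarrow> (real ^ 'd \<Rightarrow> real) \<Rightarrow> real ^ 'd \<Rightarrow> real" where
  "lik_ratio p0 p1 x = p1 x / p0 x"

definition D01 :: "(real ^ 'd \<Rightarrow> real) \<Rightarrow> (real ^ 'd \<Rightarrow> real) \<Rightarrow> ereal" where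
  "D01 p0 p1 = - ereal_integral (prob_of p0) (\<lambda>x. ln (lik_ratio p0 p1 x))"

definition D10 :: "(real ^ 'd \<Rightarrow> real) \<Rightarrow> (real ^ 'd \<Rightarrow> real) \<Rightarrow> ereal" where
  "D10 p0 p1 = ereal_integral (prob_of p1) (\<lambda>x. ln (lik_ratio p0 p1 x))"

definition weight0 :: "real \<Rightarrow> real \<Rightarrow> real" where
  "weight0 PF PM = PF * ln (PF / (1 - PM)) + (1 - PF) * ln ((1 - PF) / PM)"

definition weight1 :: "real \<Rightarrow> real \<Rightarrow> real" where
  "weight1 PF PM = PM * ln (PM / (1 - PF)) + (1 - PM) * ln ((1 - PM) / PF)"

(* Wald's zero-overshoot value of the prior-weighted expected sample size.
   Division is that of ereal, so c / \<infinity> = c / (-\<infinity>) = 0, here and below. *)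
definition sprt_avg_stopping_time ::
  "real \<Rightarrow> real \<Rightarrow> real \<Rightarrow> real \<Rightarrow> (real ^ 'd \<Rightarrow> real) \<Rightarrow> (real ^ 'd \<Rightarrow> real) \<Rightarrow> ereal" where
  "sprt_avg_stopping_time \<pi>0 \<pi>1 PF PM p0 p1 =
     ereal (\<pi>0 * weight0 PF PM) / D01 p0 p1 + ereal (\<pi>1 * weight1 PF PM) / D10 p0 p1"

definition objective ::
  "real \<Rightarrow> real \<Rightarrow> real \<Rightarrow> real \<Rightarrow> (real ^ 'd \<Rightarrow> real) \<Rightarrow> (real ^ 'd \<Rightarrow> real) \<Rightarrow>
   (real ^ 'd \<Rightarrow> real) \<Rightarrow> ereal" where
  "objective \<pi>0 \<pi>1 PF PM p0 p1 rh =
     - (ereal (\<pi>0 * weight0 PF PM) / ereal_integral (prob_of p0) (\<lambda>x. ln (rh x)))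
     + ereal (\<pi>1 * weight1 PF PM) / ereal_integral (prob_of p1) (\<lambda>x. ln (rh x))"

definition feasible ::
  "(real ^ 'd \<Rightarrow> real) set \<Rightarrow> (real ^ 'd \<Rightarrow> real) \<Rightarrow> (real ^ 'd \<Rightarrow> real) \<Rightarrow>
   (real ^ 'd \<Rightarrow> real) set" where
  "feasible R p0 p1 =
     {rh \<in> R. \<not> (AE x in prob_of p0. rh x = 1) \<and>
        (\<integral>\<^sup>+x. ennreal (rh x) \<partial>prob_of p0) = 1 \<and>
        (\<integral>\<^sup>+x. ennreal (inverse (rh x)) \<partial>prob_of p1) = 1}"

(* The infimum in ereal is \<infinity> if there is no feasible point. *)
definition optimal_value ::
  "(real ^ 'd \<Rightarrow> real) set \<Rightarrow> real \<Rightarrow> real \<Rightarrow> real \<Rightarrow> real \<Rightarrow>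
   (real ^ 'd \<Rightarrow> real) \<Rightarrow> (real ^ 'd \<Rightarrow> real) \<Rightarrow> ereal" where
  "optimal_value R \<pi>0 \<pi>1 PF PM p0 p1 =
     (INF rh\<in>feasible R p0 p1. objective \<pi>0 \<pi>1 PF PM p0 p1 rh)"

end

theory Submission imports Defs begin

text \<open>
  Writing \<open>r = p1 / p0\<close>, each feasible \<open>f\<close> gives lower bounds \<open>0 < - \<integral> ln f dP0 \<le> D01\<close> and
  \<open>0 < \<integral> ln f dP1 \<le> D10\<close>, which is all that is needed since the weights are nonnegative.
  Both bounds come from \<open>ln t \<le> t - 1\<close>: with \<open>t = f\<close> it gives positivity, and with \<open>t = r / f\<close>,
  for which \<open>\<integral> r / f dP0 = \<integral> 1 / f dP1 = 1\<close>, it gives the comparison with \<open>D01\<close>. The bounds for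
  \<open>P1\<close> are those for \<open>P0\<close> with \<open>p0\<close> and \<open>p1\<close> exchanged and \<open>f\<close> replaced by \<open>1 / f\<close>.
  To avoid differences of infinite integrals, \<open>- \<integral> ln f\<close> is rewritten as the integral of the
  nonnegative function \<open>f - 1 - ln f\<close>.
\<close>

section \<open>Logarithmic gap over an abstract probability measure\<close>

definition log_gap :: "'a measure \<Rightarrow> ('a \<Rightarrow> real) \<Rightarrow> ennreal" where
  "log_gap M f = (\<integral>\<^sup>+x. ennreal (f x - 1 - ln (f x)) \<partial>M)"

text \<open>With \<open>u\<close>, \<open>v\<close> the positive and negative parts of
  \<open>ln f\<close>, pointwise \<open>(f - 1 - ln f) + u + 1 = f + v\<close>. Integrating leaves a
  1 on both sides, which cancels. Finiteness comes from \<open>u <= f\<close>.\<close>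

lemma log_gap_parts:
  assumes "prob_space M" and [measurable]: "f \<in> borel_measurable M"
    and pos: "AE x in M. 0 < f x" and int1: "(\<integral>\<^sup>+x. ennreal (f x) \<partial>M) = 1"
  shows "log_gap M f + (\<integral>\<^sup>+x. ennreal (ln (f x)) \<partial>M) = (\<integral>\<^sup>+x. ennreal (- ln (f x)) \<partial>M)"
    and "(\<integral>\<^sup>+x. ennreal (ln (f x)) \<partial>M) < \<infinity>"
proof -
  interpret prob_space M by fact
  let ?P = "\<integral>\<^sup>+x. ennreal (ln (f x)) \<partial>M" and ?N = "\<integral>\<^sup>+x. ennreal (- ln (f x)) \<partial>M"
  have "(\<integral>\<^sup>+x. (ennreal (f x - 1 - ln (f x)) + ennreal (ln (f x))) + 1 \<partial>M)
      = (\<integral>\<^sup>+x. ennreal (f x) + ennreal (- ln (f x)) \<partial>M)"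
  proof (rule nn_integral_cong_AE, use pos in eventually_elim)
    case (elim x)
    have "0 \<le> f x - 1 - ln (f x)" using ln_le_minus_one[OF elim] by simp
    then show ?case
      using elim by (cases "0 \<le> ln (f x)")
        (simp_all add: ennreal_neg flip: ennreal_plus ennreal_1)
  qed
  then have "(log_gap M f + ?P) + 1 = ?N + 1"
    by (simp add: nn_integral_add int1 emeasure_space_1 log_gap_def add.commute)
  then show "log_gap M f + ?P = ?N" by simp
  have "?P \<le> (\<integral>\<^sup>+x. ennreal (f x) \<partial>M)"
    by (rule nn_integral_mono_AE, use pos in eventually_elim) (auto intro!: ennreal_leI dest: ln_le_minus_one)
  then show "?P < \<infinity>" using int1 by (simp add: order.strict_trans1)
qed

lemma ereal_integral_ln:
  assumes "prob_space M" and "f \<in> borel_measurable M"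
    and "AE x in M. 0 < f x" and "(\<integral>\<^sup>+x. ennreal (f x) \<partial>M) = 1"
  shows "ereal_integral M (\<lambda>x. ln (f x)) = - enn2ereal (log_gap M f)"
    and "ereal_integral M (\<lambda>x. - ln (f x)) = enn2ereal (log_gap M f)"
proof -
  have N: "enn2ereal (\<integral>\<^sup>+x. ennreal (- ln (f x)) \<partial>M)
      = enn2ereal (log_gap M f) + enn2ereal (\<integral>\<^sup>+x. ennreal (ln (f x)) \<partial>M)"
    using log_gap_parts(1)[OF assms] by (metis plus_ennreal.rep_eq)
  \<comment> \<open>Since the positive part has a finite integral, it cancels in
    \<open>ereal\<close> even when the gap is infinite.\<close>
  obtain p where p: "enn2ereal (\<integral>\<^sup>+x. ennreal (ln (f x)) \<partial>M) = ereal p"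
    using log_gap_parts(2)[OF assms]
    by (cases "\<integral>\<^sup>+x. ennreal (ln (f x)) \<partial>M") (auto simp: enn2ereal_ennreal)
  show "ereal_integral M (\<lambda>x. ln (f x)) = - enn2ereal (log_gap M f)"
    unfolding ereal_integral_def N p by (cases "enn2ereal (log_gap M f)") auto
  show "ereal_integral M (\<lambda>x. - ln (f x)) = enn2ereal (log_gap M f)"
    unfolding ereal_integral_def minus_minus N p by (cases "enn2ereal (log_gap M f)") auto
qed

text \<open>Equality in \<open>ln t <= t - 1\<close> holds only at \<open>t = 1\<close>, so a zero
  gap would force \<open>f = 1\<close> almost everywhere.\<close>

lemma log_gap_pos:
  assumes [measurable]: "f \<in> borel_measurable M" and pos: "AE x in M. 0 < f x"
    and "\<not> (AE x in M. f x = 1)"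
  shows "0 < log_gap M f"
proof (rule ccontr)
  assume "\<not> 0 < log_gap M f"
  then have "AE x in M. ennreal (f x - 1 - ln (f x)) = 0"
    by (simp add: log_gap_def nn_integral_0_iff_AE)
  with pos have "AE x in M. f x = 1"
  proof eventually_elim
    case (elim x)
    then have "ln (f x) = f x - 1"
      using ln_le_minus_one[OF elim(1)] by (simp add: ennreal_eq_0_iff)
    with elim(1) show ?case by (rule ln_eq_minus_one)
  qed
  with assms(3) show False ..
qed

lemma log_gap_le:
  assumes "prob_space M"
    and [measurable]: "f \<in> borel_measurable M" "g \<in> borel_measurable M"
    and pos: "AE x in M. 0 < f x" "AE x in M. 0 < g x"
    and int: "(\<integral>\<^sup>+x. ennreal (f x) \<partial>M) = 1" "(\<integral>\<^sup>+x. ennreal (g x) \<partial>M) = 1"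
      "(\<integral>\<^sup>+x. ennreal (g x / f x) \<partial>M) = 1"
  shows "log_gap M f \<le> log_gap M g"
proof -
  interpret prob_space M by fact
  \<comment> \<open>This is \<open>ln (g / f) <= g / f - 1\<close> with the terms moved so that
    every summand is nonnegative. The inner brackets both integrate to 2, and being finite they
    cancel even next to infinite gaps.\<close>
  have "(\<integral>\<^sup>+x. ennreal (f x - 1 - ln (f x)) + (ennreal (g x) + 1) \<partial>M)
      \<le> (\<integral>\<^sup>+x. ennreal (g x - 1 - ln (g x)) + (ennreal (f x) + ennreal (g x / f x)) \<partial>M)"
  proof (rule nn_integral_mono_AE, use pos in eventually_elim)
    case (elim x)
    have "ln (g x) - ln (f x) \<le> g x / f x - 1"
      using elim ln_le_minus_one[of "g x / f x"] by (simp add: ln_div)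
    moreover have "ln (f x) \<le> f x - 1" "ln (g x) \<le> g x - 1"
      using elim by (simp_all add: ln_le_minus_one)
    ultimately show ?case
      using elim by (simp add: ennreal_leI flip: ennreal_plus ennreal_1)
  qed
  then have "log_gap M f + 2 \<le> log_gap M g + 2"
    by (simp add: nn_integral_add int emeasure_space_1 log_gap_def)
  then show ?thesis
    by (simp add: add.commute[of _ "2::ennreal"] ennreal_add_left_cancel_le)
qed

section \<open>Densities, likelihood ratio and change of measure\<close>

lemma
  assumes "is_prob_density p"
  shows is_prob_density_measurable: "p \<in> borel_measurable borel"
    and is_prob_density_nonneg: "0 \<le> p x"
    and is_prob_density_prob_space: "prob_space (prob_of p)"
  using assms by (auto simp: is_prob_density_def)

lemma sets_prob_of [measurable_cong]: "sets (prob_of p) = sets borel"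
  by (simp add: prob_of_def)

lemma AE_prob_of:
  assumes "is_prob_density p"
  shows "(AE x in prob_of p. P x) \<longleftrightarrow> (AE x in lborel. p x \<noteq> 0 \<longrightarrow> P x)"
proof -
  have pos: "0 < p x \<longleftrightarrow> p x \<noteq> 0" for x
    using is_prob_density_nonneg[OF assms, of x] by auto
  note [measurable] = is_prob_density_measurable[OF assms]
  have "(\<lambda>x. ennreal (p x)) \<in> borel_measurable lborel" by measurable
  from AE_density[OF this] show ?thesis unfolding prob_of_def by (simp add: pos)
qed

lemma lik_ratio_measurable:
  assumes "is_prob_density q0" "is_prob_density q1"
  shows "lik_ratio q0 q1 \<in> borel_measurable borel"
  using assms[THEN is_prob_density_measurable] unfolding lik_ratio_def by measurable

lemma lik_ratio_pos_AE:
  assumes "is_prob_density q0" "is_prob_density q1"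
    and supp: "AE x in lborel. q0 x \<noteq> 0 \<longleftrightarrow> q1 x \<noteq> 0"
  shows "AE x in prob_of q0. 0 < lik_ratio q0 q1 x"
  unfolding AE_prob_of[OF assms(1)] using supp
  by eventually_elim
    (use assms(1,2)[THEN is_prob_density_nonneg] in \<open>auto simp: lik_ratio_def less_le\<close>)

text \<open>Off the common zero set \<open>q0 * (q1 / q0) = q1\<close>; on it both integrands
  vanish. The sign of \<open>h\<close> is free because truncation by \<open>ennreal\<close> commutes
  with nonnegative factors.\<close>

lemma nn_integral_change_prob_of:
  assumes q: "is_prob_density q0" "is_prob_density q1"
    and supp: "AE x in lborel. q0 x \<noteq> 0 \<longleftrightarrow> q1 x \<noteq> 0"
    and [measurable]: "h \<in> borel_measurable borel"
  shows "(\<integral>\<^sup>+x. ennreal (lik_ratio q0 q1 x * h x) \<partial>prob_of q0) = (\<integral>\<^sup>+x. ennreal (h x) \<partial>prob_of q1)"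
proof -
  note [measurable] = q[THEN is_prob_density_measurable] lik_ratio_measurable[OF q]
  note nonneg = q[THEN is_prob_density_nonneg]
  have "(\<integral>\<^sup>+x. ennreal (q0 x) * ennreal (lik_ratio q0 q1 x * h x) \<partial>lborel)
      = (\<integral>\<^sup>+x. ennreal (q1 x) * ennreal (h x) \<partial>lborel)"
    by (rule nn_integral_cong_AE, use supp in eventually_elim)
      (use nonneg in \<open>auto simp: lik_ratio_def simp flip: ennreal_mult'\<close>)
  then show ?thesis
    by (simp add: prob_of_def nn_integral_density)
qed

lemma nn_integral_lik_ratio:
  assumes "is_prob_density q0" "is_prob_density q1"
    and "AE x in lborel. q0 x \<noteq> 0 \<longleftrightarrow> q1 x \<noteq> 0"
  shows "(\<integral>\<^sup>+x. ennreal (lik_ratio q0 q1 x) \<partial>prob_of q0) = 1"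
  using nn_integral_change_prob_of[OF assms, of "\<lambda>_. 1"]
    prob_space.emeasure_space_1[OF is_prob_density_prob_space[OF assms(2)]] by simp

lemma log_gap_le_lik_ratio:
  assumes q: "is_prob_density q0" "is_prob_density q1"
    and supp: "AE x in lborel. q0 x \<noteq> 0 \<longleftrightarrow> q1 x \<noteq> 0"
    and f: "f \<in> borel_measurable borel" "\<And>x. 0 < f x"
    and int: "(\<integral>\<^sup>+x. ennreal (f x) \<partial>prob_of q0) = 1"
      "(\<integral>\<^sup>+x. ennreal (inverse (f x)) \<partial>prob_of q1) = 1"
  shows "log_gap (prob_of q0) f \<le> log_gap (prob_of q0) (lik_ratio q0 q1)"
proof (rule log_gap_le)
  note [measurable] = f(1) lik_ratio_measurable[OF q]
  show "f \<in> borel_measurable (prob_of q0)" "lik_ratio q0 q1 \<in> borel_measurable (prob_of q0)"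
    by measurable
  show "(\<integral>\<^sup>+x. ennreal (lik_ratio q0 q1 x / f x) \<partial>prob_of q0) = 1"
    using nn_integral_change_prob_of[OF q supp, of "\<lambda>x. inverse (f x)"] int(2)
    by (simp add: divide_inverse)
qed (use assms in \<open>simp_all add: is_prob_density_prob_space lik_ratio_pos_AE nn_integral_lik_ratio\<close>)

section \<open>The two divergences as logarithmic gaps\<close>

lemma D01_eq_log_gap:
  assumes "is_prob_density p0" "is_prob_density p1"
    and "AE x in lborel. p0 x \<noteq> 0 \<longleftrightarrow> p1 x \<noteq> 0"
  shows "D01 p0 p1 = enn2ereal (log_gap (prob_of p0) (lik_ratio p0 p1))"
proof -
  note [measurable] = lik_ratio_measurable[OF assms(1,2)]
  have "lik_ratio p0 p1 \<in> borel_measurable (prob_of p0)" by measurable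
  from ereal_integral_ln(1)[OF is_prob_density_prob_space[OF assms(1)] this
      lik_ratio_pos_AE[OF assms] nn_integral_lik_ratio[OF assms]]
  show ?thesis by (simp add: D01_def)
qed

lemma D10_eq_log_gap:
  assumes "is_prob_density p0" "is_prob_density p1"
    and "AE x in lborel. p0 x \<noteq> 0 \<longleftrightarrow> p1 x \<noteq> 0"
  shows "D10 p0 p1 = enn2ereal (log_gap (prob_of p1) (lik_ratio p1 p0))"
proof -
  have supp: "AE x in lborel. p1 x \<noteq> 0 \<longleftrightarrow> p0 x \<noteq> 0"
    using assms(3) by eventually_elim simp
  note [measurable] = lik_ratio_measurable[OF assms(2,1)]
  have "lik_ratio p1 p0 \<in> borel_measurable (prob_of p1)" by measurable
  note eq = ereal_integral_ln(2)[OF is_prob_density_prob_space[OF assms(2)] this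
      lik_ratio_pos_AE[OF assms(2,1) supp] nn_integral_lik_ratio[OF assms(2,1) supp]]
  \<comment> \<open>This holds at every point: where a density vanishes, both quotients are
    \<open>0\<close> and \<open>ln 0 = 0\<close>.\<close>
  have "ln (lik_ratio p0 p1 x) = - ln (lik_ratio p1 p0 x)" for x
  proof (cases "p0 x = 0 \<or> p1 x = 0")
    case False
    then show ?thesis
      using assms(1,2)[THEN is_prob_density_nonneg, of x]
      by (simp add: lik_ratio_def ln_div less_le)
  qed (auto simp: lik_ratio_def)
  with eq show ?thesis by (simp add: D10_def)
qed

section \<open>Nonnegativity of the weights and monotonicity of division\<close>

lemma bernoulli_relative_entropy_nonneg:
  fixes a b :: real
  assumes "0 < a" "a < 1" "0 < b" "b < 1"
  shows "0 \<le> a * ln (a / b) + (1 - a) * ln ((1 - a) / (1 - b))"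
proof -
  \<comment> \<open>Gibbs' inequality termwise, from \<open>ln t <= t - 1\<close> at
    \<open>t = y / x\<close>; the lower bounds \<open>a - b\<close> and
    \<open>(1 - a) - (1 - b)\<close> sum to 0.\<close>
  have *: "x - y \<le> x * ln (x / y)" if "0 < x" "0 < y" for x y :: real
    using mult_left_mono[OF ln_le_minus_one[of "y / x"], of x] that
    by (simp add: ln_div right_diff_distrib)
  from *[of a b] *[of "1 - a" "1 - b"] assms show ?thesis by simp
qed

lemma weight0_nonneg: "0 < PF \<Longrightarrow> PF < 1 \<Longrightarrow> 0 < PM \<Longrightarrow> PM < 1 \<Longrightarrow> 0 \<le> weight0 PF PM"
  using bernoulli_relative_entropy_nonneg[of PF "1 - PM"] by (simp add: weight0_def)

lemma weight1_nonneg: "0 < PF \<Longrightarrow> PF < 1 \<Longrightarrow> 0 < PM \<Longrightarrow> PM < 1 \<Longrightarrow> 0 \<le> weight1 PF PM"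
  using bernoulli_relative_entropy_nonneg[of PM "1 - PF"] by (simp add: weight1_def)

lemma ereal_divide_enn2ereal_antimono:
  assumes "0 \<le> c" "0 < a" "a \<le> b"
  shows "ereal c / enn2ereal b \<le> ereal c / enn2ereal a"
  using assms by (cases a; cases b) (auto simp: enn2ereal_ennreal top_unique intro!: divide_left_mono)

text \<open>Strict positivity matters: division by \<open>0\<close> in \<open>ereal\<close> forgets
  the sign of the divisor, so at \<open>a = 0\<close> the two minus signs would not cancel for
  \<open>c > 0\<close>.\<close>

lemma uminus_ereal_divide_uminus_enn2ereal:
  assumes "0 < a"
  shows "- (ereal c / - enn2ereal a) = ereal c / enn2ereal a"
  using assms by (cases a) (auto simp: enn2ereal_ennreal)

theorem theorem1:
  fixes p0 p1 :: "real ^ 'd \<Rightarrow> real"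
    and \<pi>0 \<pi>1 PF PM :: real
    and R :: "(real ^ 'd \<Rightarrow> real) set"
  assumes "is_prob_density p0" and "is_prob_density p1"
    and distinct: "\<not> (AE x in lborel. p0 x = p1 x)"
    and same_support: "AE x in lborel. p0 x \<noteq> 0 \<longleftrightarrow> p1 x \<noteq> 0"
    and "0 \<le> \<pi>0" and "0 \<le> \<pi>1" and "\<pi>0 + \<pi>1 = 1"
    and "0 < PF" and "PF < 1" and "0 < PM" and "PM < 1"
    and "\<And>f. f \<in> R \<Longrightarrow> f \<in> borel_measurable borel \<and> (\<forall>x. 0 < f x)"
  shows "sprt_avg_stopping_time \<pi>0 \<pi>1 PF PM p0 p1 \<le> optimal_value R \<pi>0 \<pi>1 PF PM p0 p1"
  unfolding optimal_value_def
proof (rule INF_greatest)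
  fix f assume "f \<in> feasible R p0 p1"
  with assms(12) have [measurable]: "f \<in> borel_measurable borel" and pos: "\<And>x. 0 < f x"
    and ne0: "\<not> (AE x in prob_of p0. f x = 1)"
    and int0: "(\<integral>\<^sup>+x. ennreal (f x) \<partial>prob_of p0) = 1"
    and int1: "(\<integral>\<^sup>+x. ennreal (inverse (f x)) \<partial>prob_of p1) = 1"
    by (auto simp: feasible_def)
  \<comment> \<open>\<open>g\<close> is the candidate for the exchanged pair \<open>p1\<close>,
    \<open>p0\<close>: the two integral constraints on \<open>f\<close> swap roles.\<close>
  define g where "g x = inverse (f x)" for x
  have [measurable]: "g \<in> borel_measurable borel" unfolding g_def by measurable
  have posg: "\<And>x. 0 < g x" and invg: "\<And>x. inverse (g x) = f x" using pos by (auto simp: g_def)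
  have supp': "AE x in lborel. p1 x \<noteq> 0 \<longleftrightarrow> p0 x \<noteq> 0"
    using same_support by eventually_elim simp
  \<comment> \<open>Nontriviality is given for \<open>p0\<close> only; it passes to
    \<open>p1\<close> because the common support makes the null sets agree, and
    \<open>1 / f = 1\<close> iff \<open>f = 1\<close>.\<close>
  have ne1: "\<not> (AE x in prob_of p1. g x = 1)"
  proof
    assume "AE x in prob_of p1. g x = 1"
    then have "AE x in lborel. p1 x \<noteq> 0 \<longrightarrow> f x = 1"
      by (simp add: AE_prob_of[OF assms(2)] g_def)
    with same_support have "AE x in lborel. p0 x \<noteq> 0 \<longrightarrow> f x = 1" by eventually_elim simp
    with ne0 show False by (simp add: AE_prob_of[OF assms(1)])
  qed
  have gap0: "0 < log_gap (prob_of p0) f" "0 < log_gap (prob_of p1) g"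
    by (rule log_gap_pos; use pos posg ne0 ne1 in simp)+
  have le0: "log_gap (prob_of p0) f \<le> log_gap (prob_of p0) (lik_ratio p0 p1)"
    by (rule log_gap_le_lik_ratio) (use assms pos int0 int1 in simp_all)
  have le1: "log_gap (prob_of p1) g \<le> log_gap (prob_of p1) (lik_ratio p1 p0)"
    by (rule log_gap_le_lik_ratio)
      (use assms posg supp' int0 int1 in \<open>simp_all add: invg, simp_all add: g_def\<close>)
  have I0: "ereal_integral (prob_of p0) (\<lambda>x. ln (f x)) = - enn2ereal (log_gap (prob_of p0) f)"
    by (rule ereal_integral_ln) (use assms pos int0 in \<open>simp_all add: is_prob_density_prob_space\<close>)
  have "ereal_integral (prob_of p1) (\<lambda>x. - ln (g x)) = enn2ereal (log_gap (prob_of p1) g)"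
    by (rule ereal_integral_ln)
      (use assms posg int1 in \<open>simp_all add: is_prob_density_prob_space flip: g_def\<close>)
  then have I1: "ereal_integral (prob_of p1) (\<lambda>x. ln (f x)) = enn2ereal (log_gap (prob_of p1) g)"
    using pos by (simp add: g_def ln_inverse)
  \<comment> \<open>The two terms are compared separately: replacing a divergence by a smaller
    positive denominator can only increase a nonnegative quotient.\<close>
  have "ereal (\<pi>0 * weight0 PF PM) / D01 p0 p1
      \<le> ereal (\<pi>0 * weight0 PF PM) / enn2ereal (log_gap (prob_of p0) f)"
    unfolding D01_eq_log_gap[OF assms(1,2) same_support]
    using assms gap0 le0 weight0_nonneg[of PF PM] by (intro ereal_divide_enn2ereal_antimono) auto
  moreover have "ereal (\<pi>1 * weight1 PF PM) / D10 p0 p1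
      \<le> ereal (\<pi>1 * weight1 PF PM) / enn2ereal (log_gap (prob_of p1) g)"
    unfolding D10_eq_log_gap[OF assms(1,2) same_support]
    using assms gap0 le1 weight1_nonneg[of PF PM] by (intro ereal_divide_enn2ereal_antimono) auto
  ultimately show "sprt_avg_stopping_time \<pi>0 \<pi>1 PF PM p0 p1 \<le> objective \<pi>0 \<pi>1 PF PM p0 p1 f"
    unfolding sprt_avg_stopping_time_def objective_def I0 I1
    by (simp add: add_mono uminus_ereal_divide_uminus_enn2ereal[OF gap0(1)])
qed

end
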